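(* Let $k\geq 3$, $t\geq s\geq 1$ and $\beta\geq 0$ be fixed integers, and let $n$ be sufficiently large (depending on $s,t,k,\beta$). Put $m=\lfloor (s+\beta)k/(\beta+1)\rfloor$ and $\hat\beta=\hat\beta(k,s,\beta)$. Let $\mathcal{F}\subseteq\binom{[n]}{k}$ be an $(s,t)$-union intersecting family with $\ell(\mathcal{F})\geq s+\beta$. Then $$|\mathcal{F}|\leq \binom{n-1}{k-1}-\binom{n-m-1}{k-1}+s+t+\hat\beta-1.$$ Equality holds if and only if there exist pairwise distinct $k$-sets $A_1,\ldots,A_{s+\hat\beta},F_1,\ldots,F_{t-1}$ such that (1) $1\notin\bigcup_{i=1}^{s+\hat\beta}A_i$; (2) $|T(A_1,\ldots,A_{s+\hat\beta}:s)|=m$; (3) for each $i\leq t-1$, $F_i\in \mathcal{S}_1\setminus \mathcal{S}_1(A_1,\ldots,A_{s+\hat\beta}:s)$; (4) the family $\{A_1,\ldots,A_{s+\hat\beta},F_1,\ldots,F_{t-1}\}$ is $(s,t)$-union intersecting; and $\mathcal{F}$ is isomorphic to $\mathcal{S}_1(A_1,\ldots,A_{s+\hat\beta}:s)\cup\{A_1,\ldots,A_{s+\hat\beta}\}\cup\{F_1,\ldots,F_{t-1}\}$.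
   Context: $[n]=\{1,\ldots,n\}$ and $\binom{[n]}{k}$ is the family of $k$-subsets of $[n]$. A family is intersecting if any two of its members meet. For $s,t\ge1$, a family $\mathcal{F}\subseteq\binom{[n]}{k}$ is $(s,t)$-union intersecting if for any pairwise distinct $A_1,\ldots,A_{s+t}\in\mathcal{F}$, $(\bigcup_{i=1}^s A_i)\cap(\bigcup_{i=1}^t A_{s+i})\neq\varnothing$. $\ell(\mathcal{F})$ is the minimum number of members of $\mathcal{F}$ whose removal leaves an intersecting family. $\mathcal{S}_1=\{A\in\binom{[n]}{k}:1\in A\}$. For $k$-sets $A_1,\ldots,A_p$ ($p\ge s$) not containing $1$: $\mathcal{S}_1(A_1,\ldots,A_p:s)$ is the family of all $A\in\mathcal{S}_1$ that are disjoint from at most $s-1$ of the $A_i$; and $T(A_1,\ldots,A_p:s)$ is the set of elements $x$ lying in at least $p-s+1$ of the sets $A_1,\ldots,A_p$ (i.e. in $A_{i_1}\cap\cdots\cap A_{i_{p-s+1}}$ for some distinct indices). For nonnegative integers $k,s,\beta$ with $s\ge1$: if $\lfloor (s+\beta)k/(\beta+1)\rfloor>k$, $\hat\beta(k,s,\beta)$ is the largest positive integer $b$ with $\lfloor (s+b)k/(b+1)\rfloor=\lfloor (s+\beta)k/(\beta+1)\rfloor$; if $\lfloor (s+\beta)k/(\beta+1)\rfloor=k$, $\hat\beta(k,s,\beta)=\beta$. Two families are isomorphic if some permutation of $[n]$ maps one onto the other.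
   Formalization: In the definition of β̂ the largest b is taken over nonnegative rather than positive integers: for β=0 and s≥2 no positive b satisfies the equation, so β̂ would be undefined; here β̂=0. For β≥1 the two definitions agree. *)

theory Defs
  imports Complex_Main "HOL-Library.Ramsey" "HOL-Combinatorics.Permutations"
begin

text \<open>The ground set is \<^term>\<open>{1..n::nat}\<close>, and its family of \<^term>\<open>k\<close>-subsets is
  \<^term>\<open>nsets {1..n::nat} k\<close>.  Finite sequences of sets are functions on \<^typ>\<open>nat\<close>, used only on
  indices \<^term>\<open>{1..p::nat}\<close>.\<close>

definition intersecting :: "nat set set \<Rightarrow> bool" where
  "intersecting \<F> \<longleftrightarrow> (\<forall>A\<in>\<F>. \<forall>B\<in>\<F>. A \<inter> B \<noteq> {})"

definition union_intersecting :: "nat \<Rightarrow> nat \<Rightarrow> nat set set \<Rightarrow> bool" where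
  "union_intersecting s t \<F> \<longleftrightarrow>
     (\<forall>A :: nat \<Rightarrow> nat set. inj_on A {1..s+t} \<and> A ` {1..s+t} \<subseteq> \<F> \<longrightarrow>
        (\<Union>i\<in>{1..s}. A i) \<inter> (\<Union>i\<in>{1..t}. A (s + i)) \<noteq> {})"

definition ell :: "nat set set \<Rightarrow> nat" where
  "ell \<F> = (LEAST j. \<exists>\<R>\<subseteq>\<F>. finite \<R> \<and> card \<R> = j \<and> intersecting (\<F> - \<R>))"

definition star1 :: "nat \<Rightarrow> nat \<Rightarrow> nat set set" where
  "star1 n k = {B \<in> nsets {1..n} k. 1 \<in> B}"

text \<open>\<open>star1_rel n k p A s\<close> is $\mathcal{S}_1(A_1,\ldots,A_p:s)$, and \<open>core p A s\<close> is
  $T(A_1,\ldots,A_p:s)$; both are used for \<^prop>\<open>(1::nat) \<le> s\<close> and \<^prop>\<open>(s::nat) \<le> p\<close>, so the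
  subtractions do not truncate.\<close>

definition star1_rel :: "nat \<Rightarrow> nat \<Rightarrow> nat \<Rightarrow> (nat \<Rightarrow> nat set) \<Rightarrow> nat \<Rightarrow> nat set set" where
  "star1_rel n k p A s = {B \<in> star1 n k. card {i \<in> {1..p}. B \<inter> A i = {}} \<le> s - 1}"

definition core :: "nat \<Rightarrow> (nat \<Rightarrow> nat set) \<Rightarrow> nat \<Rightarrow> nat set" where
  "core p A s = {x. p - s + 1 \<le> card {i \<in> {1..p}. x \<in> A i}}"

definition core_bound :: "nat \<Rightarrow> nat \<Rightarrow> nat \<Rightarrow> nat" where
  "core_bound k s \<beta> = nat \<lfloor>real ((s + \<beta>) * k) / real (\<beta> + 1)\<rfloor>"

text \<open>The largest \<open>b\<close> below ranges over the nonnegative integers.  For \<^prop>\<open>(\<beta>::nat) > 0\<close> this is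
  the same as the largest positive one (lemma \<open>beta_hat_positive\<close>).  For \<^prop>\<open>(\<beta>::nat) = 0\<close> and
  \<^prop>\<open>(s::nat) \<ge> 2\<close> only \<^prop>\<open>(b::nat) = 0\<close> satisfies the equation, and the value is \<open>0\<close>
  (lemma \<open>beta_hat_zero\<close>).\<close>

definition beta_hat :: "nat \<Rightarrow> nat \<Rightarrow> nat \<Rightarrow> nat" where
  "beta_hat k s \<beta> =
     (if core_bound k s \<beta> > k
      then (GREATEST b. core_bound k s b = core_bound k s \<beta>)
      else \<beta>)"

definition isomorphic_families :: "nat \<Rightarrow> nat set set \<Rightarrow> nat set set \<Rightarrow> bool" where
  "isomorphic_families n \<F> \<G> \<longleftrightarrow> (\<exists>\<pi>. \<pi> permutes {1..n} \<and> (\<lambda>A. \<pi> ` A) ` \<F> = \<G>)"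

lemma core_bound_div: "core_bound k s \<beta> = (s + \<beta>) * k div (\<beta> + 1)"
  unfolding core_bound_def by (metis floor_divide_of_nat_eq nat_int)

lemma core_bound_zero_eq:
  assumes "core_bound k s b = core_bound k s 0" "core_bound k s b > k"
  shows "b = 0"
proof (rule ccontr)
  assume "b \<noteq> 0"
  have eq: "(s + b) * k div (b + 1) = s * k" using assms(1) by (simp add: core_bound_div)
  have sk: "s * k > k" using assms by (simp add: core_bound_div)
  then have k: "k > 0" by (cases "k = 0") auto
  from sk have s: "s > 1"
    by (metis One_nat_def Suc_lessI bot_nat_0.not_eq_extremum less_irrefl mult_0 mult_1 not_less0)
  have "s * k * (b + 1) \<le> (s + b) * k"
    using eq by (metis div_times_less_eq_dividend)
  then have "s * (b + 1) \<le> s + b" using k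
    by (metis mult.assoc mult.commute mult_le_cancel2)
  then have "s * b \<le> b" by (simp add: algebra_simps)
  then have "s \<le> 1" using mult_le_cancel2[of s b 1] \<open>b \<noteq> 0\<close> by simp
  with s show False by simp
qed

lemma beta_hat_positive:
  assumes "\<beta> > 0" "core_bound k s \<beta> > k"
  shows "beta_hat k s \<beta> = (GREATEST b. b > 0 \<and> core_bound k s b = core_bound k s \<beta>)"
proof -
  have "core_bound k s 0 \<noteq> core_bound k s \<beta>"
    using core_bound_zero_eq[of k s \<beta>] assms by auto
  then have "(core_bound k s b = core_bound k s \<beta>) \<longleftrightarrow>
      (b > 0 \<and> core_bound k s b = core_bound k s \<beta>)" for b
    by (cases b) auto
  then show ?thesis using assms unfolding beta_hat_def by presburger
qed

lemma beta_hat_zero: "beta_hat k s 0 = 0"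
proof (cases "core_bound k s 0 > k")
  case True
  then have "(GREATEST b. core_bound k s b = core_bound k s 0) = 0"
    by (intro Greatest_equality) (use core_bound_zero_eq[of k s] in \<open>metis le_refl\<close>)+
  then show ?thesis by (simp add: beta_hat_def)
qed (simp add: beta_hat_def)

text \<open>The set over which the maximum is taken is bounded, so the maximum is attained.\<close>

lemma core_bound_beta_hat:
  "core_bound k s (beta_hat k s \<beta>) = core_bound k s \<beta>" "\<beta> \<le> beta_hat k s \<beta>"
proof -
  have *: "b \<le> s * k" if "core_bound k s b = core_bound k s \<beta>" "core_bound k s \<beta> > k" for b
  proof -
    have "k + 1 \<le> (s + b) * k div (b + 1)" using that by (simp add: core_bound_div)
    then have "(k + 1) * (b + 1) \<le> (s + b) * k"
      by (metis div_times_less_eq_dividend le_trans mult_le_mono1)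
    then show ?thesis by (simp add: algebra_simps)
  qed
  have "core_bound k s (beta_hat k s \<beta>) = core_bound k s \<beta> \<and> \<beta> \<le> beta_hat k s \<beta>"
  proof (cases "core_bound k s \<beta> > k")
    case True
    let ?P = "\<lambda>b. core_bound k s b = core_bound k s \<beta>"
    have "?P (Greatest ?P)" by (rule GreatestI_nat[where k=\<beta> and b="s*k"]) (use * True in auto)
    moreover have "\<beta> \<le> Greatest ?P" by (rule Greatest_le_nat[where b="s*k"]) (use * True in auto)
    ultimately show ?thesis using True by (simp add: beta_hat_def)
  qed (simp add: beta_hat_def)
  then show "core_bound k s (beta_hat k s \<beta>) = core_bound k s \<beta>" "\<beta> \<le> beta_hat k s \<beta>" by auto
qed

end

theory Submission imports Defs begin

text \<open>Call a pair heavy if it lies in more than a large constant times \<open>(n - 3) choose (k - 3)\<close> members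
  of the family. If the family is at least as large as the claimed bound, all but
  \<open>O((n - 3) choose (k - 3))\<close> of its members contain a heavy pair, so there are at least \<open>m\<close> heavy
  pairs. A heavy pair is missed by fewer than \<open>s\<close> members, since \<open>t\<close> sets through the pair avoid any
  given \<open>s\<close> such members; hence heavy pairs meet each other. They do not form a triangle, as this
  would give \<open>ell \<le> 3 * (s - 1)\<close>, so they form a star with centre \<open>x\<close> and leaves \<open>Y\<close>. Let \<open>G\<close>
  consist of the \<open>s + b\<close> members avoiding \<open>x\<close>. Every \<open>y \<in> Y\<close> lies in at least \<open>b + 1\<close> sets of \<open>G\<close>;
  counting incidences gives \<open>card Y = m\<close> and \<open>\<beta> \<le> b \<le> bh\<close>, and the rounding remainder forces at
  least \<open>s\<close> sets of \<open>G\<close> to lie inside \<open>Y\<close>. So at most \<open>t - 1\<close> members through \<open>x\<close> are disjoint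
  from \<open>Y\<close>.\<close>

section \<open>Counting\<close>

lemma finite_nsets_interval: "finite (nsets {1..n::nat} k)"
  by (simp add: finite_imp_finite_nsets)

lemma finite_subfamily: "\<F> \<subseteq> nsets {1..n::nat} k \<Longrightarrow> finite \<F>"
  using finite_nsets_interval finite_subset by blast

lemma card_nsets_superset:
  assumes "finite V" "S \<subseteq> V" "card S \<le> k"
  shows "card {B \<in> nsets V k. S \<subseteq> B} = (card V - card S) choose (k - card S)"
proof -
  have fS: "finite S" using assms finite_subset by blast
  have "bij_betw (\<lambda>C. C \<union> S) (nsets (V - S) (k - card S)) {B \<in> nsets V k. S \<subseteq> B}"
  proof (rule bij_betw_byWitness[where f' = "\<lambda>B. B - S"])
    show "(\<lambda>C. C \<union> S) ` nsets (V - S) (k - card S) \<subseteq> {B \<in> nsets V k. S \<subseteq> B}"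
    proof (clarsimp simp: nsets_def)
      fix C assume C: "C \<subseteq> V - S" "finite C" "card C = k - card S"
      have "card (C \<union> S) = card C + card S"
        by (rule card_Un_disjoint) (use C fS in auto)
      then show "C \<subseteq> V \<and> S \<subseteq> V \<and> finite S \<and> card (C \<union> S) = k"
        using C assms fS by auto
    qed
    show "(\<lambda>B. B - S) ` {B \<in> nsets V k. S \<subseteq> B} \<subseteq> nsets (V - S) (k - card S)"
      using fS by (auto simp: nsets_def card_Diff_subset)
  qed (auto simp: nsets_def)
  then have "card {B \<in> nsets V k. S \<subseteq> B} = card (nsets (V - S) (k - card S))"
    by (rule bij_betw_same_card[symmetric])
  also have "\<dots> = card (V - S) choose (k - card S)"
    using assms by (metis card_nsets)
  finally show ?thesis using assms fS by (simp add: card_Diff_subset)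
qed

lemma card_nsets_superset_le:
  assumes "finite V"
  shows "card {B \<in> nsets V k. S \<subseteq> B} \<le> (card V - card S) choose (k - card S)"
proof (cases "S \<subseteq> V \<and> card S \<le> k")
  case True
  then show ?thesis using card_nsets_superset[OF assms] by simp
next
  case False
  have "S \<subseteq> V \<and> card S \<le> k" if "B \<in> nsets V k" "S \<subseteq> B" for B
    using that card_mono[of B S] by (auto simp: nsets_def)
  then have "{B \<in> nsets V k. S \<subseteq> B} = {}" using False by blast
  then show ?thesis by (metis card.empty le0)
qed

text \<open>The sets through 1 avoiding \<open>T\<close> are the \<open>k\<close>-subsets through 1
  of the complement of \<open>T\<close>. With \<open>T\<close> the core, this counts the main part
  of the extremal families; the additive form avoids truncated subtraction.\<close>

lemma card_star1_meeting:
  assumes "n \<ge> 1" "k \<ge> 1" "T \<subseteq> {1..n} - {1}"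
  shows "card {B \<in> star1 n k. B \<inter> T \<noteq> {}} + ((n - card T - 1) choose (k - 1)) = (n - 1) choose (k - 1)"
proof -
  have fT: "finite T" using assms(3) finite_subset by blast
  have fin: "finite (star1 n k)" using finite_nsets_interval by (simp add: star1_def)
  have a: "card (star1 n k) = (n - 1) choose (k - 1)"
    using card_nsets_superset[of "{1..n}" "{1}" k] assms by (simp add: star1_def)
  have "{B \<in> star1 n k. B \<inter> T = {}} = {B \<in> nsets ({1..n} - T) k. {1} \<subseteq> B}"
    by (auto simp: star1_def nsets_def)
  moreover have "card ({1..n} - T) = n - card T"
    using assms(3) fT by (subst card_Diff_subset) auto
  ultimately have b: "card {B \<in> star1 n k. B \<inter> T = {}} = (n - card T - 1) choose (k - 1)"
    using card_nsets_superset[of "{1..n} - T" "{1}" k] assms by auto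
  have "star1 n k = {B \<in> star1 n k. B \<inter> T \<noteq> {}} \<union> {B \<in> star1 n k. B \<inter> T = {}}" by auto
  moreover have "card \<dots> = card {B \<in> star1 n k. B \<inter> T \<noteq> {}} + card {B \<in> star1 n k. B \<inter> T = {}}"
    using fin by (intro card_Un_disjoint) auto
  ultimately show ?thesis using a b by simp
qed

section \<open>Shifting the upper entry of a binomial coefficient\<close>

text \<open>Pascal's rule is applied \<open>i\<close> times; each step loses at most
  \<open>(M - 1) choose (c - 1)\<close>.\<close>

lemma binomial_shift_le:
  assumes "c \<ge> 1" "i \<le> M"
  shows "(M choose c) \<le> ((M - i) choose c) + i * ((M - 1) choose (c - 1))"
  using assms(2)
proof (induction i)
  case (Suc i)
  obtain c' where c': "c = Suc c'" using assms(1) by (cases c) auto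
  have "M - i = Suc (M - Suc i)" using Suc.prems by simp
  then have "(M - i) choose c = ((M - Suc i) choose c) + ((M - Suc i) choose c')"
    by (simp add: c')
  moreover have "(M - Suc i) choose c' \<le> (M - 1) choose c'"
    by (rule binomial_right_mono) auto
  ultimately show ?case using Suc by (simp add: c')
qed simp

text \<open>Pascal's rule again, now with each loss bounded from below: by
  \<open>binomial_shift_le\<close>, loss number \<open>j\<close>, counted from 0, falls short of
  \<open>(N - 1) choose (a - 1)\<close> by at most \<open>j * ((N - 2) choose (a - 2))\<close>. The
  square term covers the sum of these errors.\<close>

lemma binomial_shift_ge:
  assumes "a \<ge> 2" "i < N"
  shows "((N - i) choose a) + i * ((N - 1) choose (a - 1))
    \<le> (N choose a) + i\<^sup>2 * ((N - 2) choose (a - 2))"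
  using assms(2)
proof (induction i)
  case (Suc i)
  obtain a' where a': "a = Suc a'" "a' \<ge> 1" using assms(1) by (cases a) auto
  have "N - i = Suc (N - Suc i)" using Suc.prems by simp
  then have "(N - i) choose a = ((N - Suc i) choose a) + ((N - Suc i) choose a')"
    by (simp add: a')
  moreover have "(N - 1) choose a' \<le> ((N - 1 - i) choose a') + i * ((N - 1 - 1) choose (a' - 1))"
    using Suc.prems a' by (intro binomial_shift_le) auto
  moreover have "N - 1 - i = N - Suc i" "N - 1 - 1 = N - 2" "a - 1 = a'" "a - 2 = a' - 1"
    using a' by auto
  moreover have "(Suc i)\<^sup>2 * X = i\<^sup>2 * X + i * X + (i + 1) * X" for X :: nat
    by (simp add: power2_eq_square algebra_simps)
  ultimately show ?case using Suc by (simp add: a')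
qed simp

section \<open>Arithmetic of \<open>core_bound\<close> and \<open>beta_hat\<close>\<close>

text \<open>Writing \<open>(s + b) * k\<close> as \<open>(s - 1) * k + k * (b + 1)\<close> takes
  \<open>k\<close> out of the quotient. Monotonicity in \<open>b\<close> becomes visible, and the
  value is \<open>k\<close> exactly when \<open>(s - 1) * k \<le> b\<close>.\<close>

lemma core_bound_alt:
  assumes "s \<ge> 1"
  shows "core_bound k s b = k + (s - 1) * k div (b + 1)"
proof -
  obtain s' where "s = Suc s'" using assms by (cases s) auto
  then have "(s + b) * k = s' * k + k * (b + 1)" by (simp add: algebra_simps)
  then have "(s + b) * k div (b + 1) = k + s' * k div (b + 1)"
    by (metis Suc_eq_plus1 div_mult_self1 nat.distinct(1))
  then show ?thesis using \<open>s = Suc s'\<close> by (simp add: core_bound_div)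
qed

lemma core_bound_antimono:
  assumes "s \<ge> 1" "b \<le> b'"
  shows "core_bound k s b' \<le> core_bound k s b"
  using assms by (simp add: core_bound_alt div_le_mono2)

text \<open>Once \<open>b' > (s - 1) * k\<close>, the quotient in \<open>core_bound_alt\<close>
  vanishes and the value drops to \<open>k\<close>. So the candidates are bounded and
  \<open>GREATEST\<close> is a true maximum.\<close>

lemma le_beta_hat:
  assumes "s \<ge> 1" "core_bound k s b = core_bound k s \<beta>" "core_bound k s \<beta> > k"
  shows "b \<le> beta_hat k s \<beta>"
proof -
  have "b' \<le> (s - 1) * k" if "core_bound k s b' = core_bound k s \<beta>" for b'
  proof (rule ccontr)
    assume "\<not> ?thesis"
    then have "(s - 1) * k div (b' + 1) = 0" by (intro div_less) simp
    then show False using that assms by (simp add: core_bound_alt)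
  qed
  then show ?thesis using assms unfolding beta_hat_def
    by (simp add: Greatest_le_nat[where b = "(s - 1) * k"])
qed

lemma double_count:
  assumes "finite X" "finite Y"
  shows "(\<Sum>x\<in>X. card {y \<in> Y. R x y}) = (\<Sum>y\<in>Y. card {x \<in> X. R x y})"
proof -
  have 1: "card {y \<in> Y. R x y} = (\<Sum>y\<in>Y. if R x y then 1 else 0)" for x
    using assms by (simp add: sum.If_cases Int_def)
  have 2: "card {x \<in> X. R x y} = (\<Sum>x\<in>X. if R x y then 1 else 0)" for y
    using assms by (simp add: sum.If_cases Int_def)
  show ?thesis unfolding 1 2 by (rule sum.swap)
qed

section \<open>Cores\<close>

text \<open>Incidences between \<open>Y\<close> and \<open>G\<close> are counted twice: a point of
  \<open>Y\<close> has at least \<open>b + 1\<close>, a set \<open>A\<close> in \<open>G\<close>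
  exactly \<open>k - card (A - Y)\<close>. The second claim keeps the part outside \<open>Y\<close>,
  which becomes small when the first is tight.\<close>

lemma core_size_bound:
  assumes "finite G" "finite Y" "card G = s + b" "\<And>A. A \<in> G \<Longrightarrow> finite A \<and> card A = k"
    and "\<And>y. y \<in> Y \<Longrightarrow> b + 1 \<le> card {A \<in> G. y \<in> A}"
  shows "card Y \<le> core_bound k s b"
    and "card Y * (b + 1) + (\<Sum>A\<in>G. card (A - Y)) \<le> (s + b) * k"
proof -
  have "card Y * (b + 1) \<le> (\<Sum>y\<in>Y. card {A \<in> G. y \<in> A})"
    using sum_bounded_below[of Y "b + 1" "\<lambda>y. card {A \<in> G. y \<in> A}"] assms(5) by simp
  also have "\<dots> = (\<Sum>A\<in>G. card {y \<in> Y. y \<in> A})"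
    by (rule double_count[OF assms(2,1)])
  finally have 1: "card Y * (b + 1) \<le> (\<Sum>A\<in>G. card {y \<in> Y. y \<in> A})" .
  have "card {y \<in> Y. y \<in> A} + card (A - Y) = k" if "A \<in> G" for A
  proof -
    have "{y \<in> Y. y \<in> A} = A \<inter> Y" by auto
    then show ?thesis using assms(4)[OF that] card_Int_Diff[of A Y] by simp
  qed
  then have "(\<Sum>A\<in>G. card {y \<in> Y. y \<in> A}) + (\<Sum>A\<in>G. card (A - Y)) = (s + b) * k"
    using assms(3) by (simp flip: sum.distrib)
  with 1 show 2: "card Y * (b + 1) + (\<Sum>A\<in>G. card (A - Y)) \<le> (s + b) * k" by simp
  then have "card Y * (b + 1) \<le> (s + b) * k" by linarith
  then show "card Y \<le> core_bound k s b"
    by (simp add: core_bound_div less_eq_div_iff_mult_less_eq)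
qed

text \<open>When the core is as large as possible, the rounding remainder \<open>\<le> b\<close> bounds the total number
  of incidences outside it, so that \<open>s\<close> of the sets lie inside it.\<close>

lemma few_outside_core:
  assumes "finite G" "finite Y" "card G = s + b" "\<And>A. A \<in> G \<Longrightarrow> finite A \<and> card A = k"
    and "\<And>y. y \<in> Y \<Longrightarrow> b + 1 \<le> card {A \<in> G. y \<in> A}"
    and "card Y = core_bound k s b"
  shows "card {A \<in> G. \<not> A \<subseteq> Y} \<le> b" and "s \<le> card {A \<in> G. A \<subseteq> Y}"
proof -
  have "(s + b) * k < (card Y + 1) * (b + 1)"
    using dividend_less_div_times[of "b + 1" "(s + b) * k"]
    unfolding assms(6) core_bound_div add_mult_distrib by simp
  then have "(\<Sum>A\<in>G. card (A - Y)) \<le> b"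
    using core_size_bound(2)[OF assms(1-5)] by (simp add: algebra_simps)
  moreover have "card {A \<in> G. \<not> A \<subseteq> Y} \<le> (\<Sum>A\<in>{A \<in> G. \<not> A \<subseteq> Y}. card (A - Y))"
  proof -
    have "1 \<le> card (A - Y)" if "A \<in> {A \<in> G. \<not> A \<subseteq> Y}" for A
      using that assms(4)[of A] by (auto simp: Suc_le_eq card_gt_0_iff)
    then show ?thesis using sum_bounded_below[of "{A \<in> G. \<not> A \<subseteq> Y}" 1 "\<lambda>A. card (A - Y)"] by simp
  qed
  moreover have "(\<Sum>A\<in>{A \<in> G. \<not> A \<subseteq> Y}. card (A - Y)) \<le> (\<Sum>A\<in>G. card (A - Y))"
    by (rule sum_mono2) (use assms in auto)
  ultimately show 1: "card {A \<in> G. \<not> A \<subseteq> Y} \<le> b" by linarith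
  have "G = {A \<in> G. \<not> A \<subseteq> Y} \<union> {A \<in> G. A \<subseteq> Y}" by auto
  then have "s + b \<le> card {A \<in> G. \<not> A \<subseteq> Y} + card {A \<in> G. A \<subseteq> Y}"
    using assms(3) by (metis (no_types, lifting) card_Un_le)
  with 1 show "s \<le> card {A \<in> G. A \<subseteq> Y}" by linarith
qed

text \<open>If the core has \<open>k\<close> elements, each \<open>A \<noteq> Y\<close> in \<open>G\<close> misses one of them. In the case
  \<open>core_bound k s \<beta> = k\<close>, where \<open>k * (s - 1) \<le> \<beta>\<close>, this leaves only \<open>b = \<beta> = 0\<close>.\<close>

lemma card_le_of_core_card_eq:
  assumes "finite G" "card G = s + b" "\<And>A. A \<in> G \<Longrightarrow> finite A \<and> card A = k" "k \<ge> 1" "s \<ge> 1"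
    and "finite Y" "card Y = k" "\<And>y. y \<in> Y \<Longrightarrow> card {A \<in> G. y \<notin> A} \<le> s - 1"
  shows "s + b \<le> 1 + k * (s - 1)"
proof -
  have "card (G - {Y}) \<le> (\<Sum>A\<in>G - {Y}. card {y \<in> Y. y \<notin> A})"
  proof -
    have "1 \<le> card {y \<in> Y. y \<notin> A}" if A: "A \<in> G - {Y}" for A
    proof -
      have "\<not> Y \<subseteq> A" using A assms(3)[of A] assms(7) by (metis DiffE card_subset_eq insertI1)
      then have "{y \<in> Y. y \<notin> A} \<noteq> {}" by auto
      then show ?thesis using assms(6) by (simp add: Suc_le_eq card_gt_0_iff)
    qed
    then show ?thesis using sum_bounded_below[of "G - {Y}" 1 "\<lambda>A. card {y \<in> Y. y \<notin> A}"] by simp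
  qed
  also have "\<dots> \<le> (\<Sum>A\<in>G. card {y \<in> Y. y \<notin> A})" using assms(1) by (intro sum_mono2) auto
  also have "\<dots> = (\<Sum>y\<in>Y. card {A \<in> G. y \<notin> A})"
    by (rule double_count[OF assms(1,6)])
  also have "\<dots> \<le> k * (s - 1)" using sum_bounded_above[of Y "\<lambda>y. card {A \<in> G. y \<notin> A}" "s - 1"] assms(7,8) by simp
  finally have "card (G - {Y}) \<le> k * (s - 1)" .
  moreover have "card G \<le> card (G - {Y}) + 1"
    using assms(1) by (cases "Y \<in> G") (simp_all add: card_Diff_singleton)
  ultimately show ?thesis using assms(2) by linarith
qed

section \<open>Extremal families\<close>

text \<open>Passes from counts over indices to counts over sets. As \<open>A\<close> is any
  injective map, it also serves for the image of a family under a permutation.\<close>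

lemma card_index_set:
  assumes "inj_on A I"
  shows "card {i \<in> I. P (A i)} = card {B \<in> A ` I. P B}"
proof -
  have "{B \<in> A ` I. P B} = A ` {i \<in> I. P (A i)}" by auto
  moreover have "inj_on A {i \<in> I. P (A i)}" using assms by (auto simp: inj_on_def)
  ultimately show ?thesis by (simp add: card_image)
qed

lemma core_eq:
  assumes "inj_on A {1..s + b}"
  shows "core (s + b) A s = {x. b + 1 \<le> card {B \<in> A ` {1..s + b}. x \<in> B}}"
  using card_index_set[OF assms, where P = "\<lambda>B. _ \<in> B"] by (simp add: core_def del: atLeastAtMost_iff)

text \<open>When the core has its maximal size, missing at least \<open>s\<close> of the sets
  amounts to missing the core: \<open>s\<close> of them lie inside it, while each of its points lies
  in all but at most \<open>s - 1\<close> of them.\<close>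

lemma star1_rel_eq_meeting_core:
  assumes "inj_on A {1..s + b}" "A ` {1..s + b} \<subseteq> nsets {1..n} k" "s \<ge> 1"
    and "card (core (s + b) A s) = core_bound k s b"
  shows "star1_rel n k (s + b) A s = {B \<in> star1 n k. B \<inter> core (s + b) A s \<noteq> {}}"
    and "core (s + b) A s \<subseteq> \<Union>(A ` {1..s + b})"
proof -
  define G where "G = A ` {1..s + b}"
  define Y where "Y = core (s + b) A s"
  have Y: "Y = {x. b + 1 \<le> card {B \<in> G. x \<in> B}}"
    using core_eq[OF assms(1)] by (simp add: G_def Y_def)
  have cG: "card G = s + b" using assms(1) by (simp add: G_def card_image)
  have fG: "finite G" by (simp add: G_def)
  have Gk: "finite B \<and> card B = k" if "B \<in> G" for B
    using that assms(2) by (auto simp: G_def nsets_def)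
  have YU: "Y \<subseteq> \<Union>G"
  proof
    fix x assume "x \<in> Y"
    then have "{B \<in> G. x \<in> B} \<noteq> {}" unfolding Y by (force simp del: Collect_empty_eq)
    then show "x \<in> \<Union>G" by blast
  qed
  then show "core (s + b) A s \<subseteq> \<Union>(A ` {1..s + b})" by (simp add: Y_def G_def)
  have fY: "finite Y" by (rule finite_subset[OF YU]) (use fG Gk in auto)
  have many: "s \<le> card {A \<in> G. A \<subseteq> Y}"
    by (rule few_outside_core(2)[OF fG fY cG]) (use Gk Y assms(4) Y_def in auto)
  have "card {i \<in> {1..s + b}. B \<inter> A i = {}} \<le> s - 1 \<longleftrightarrow> B \<inter> Y \<noteq> {}" for B
  proof -
    have eq: "card {i \<in> {1..s + b}. B \<inter> A i = {}} = card {C \<in> G. B \<inter> C = {}}"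
      unfolding G_def by (rule card_index_set[OF assms(1)])
    show ?thesis
    proof
      assume le: "card {i \<in> {1..s + b}. B \<inter> A i = {}} \<le> s - 1"
      show "B \<inter> Y \<noteq> {}"
      proof
        assume "B \<inter> Y = {}"
        then have "card {A \<in> G. A \<subseteq> Y} \<le> card {C \<in> G. B \<inter> C = {}}"
          using fG by (intro card_mono) auto
        then show False using le eq many assms(3) by linarith
      qed
    next
      assume "B \<inter> Y \<noteq> {}"
      then obtain y where y: "y \<in> B" "y \<in> Y" by auto
      have "card {C \<in> G. B \<inter> C = {}} + card {C \<in> G. y \<in> C} \<le> card G"
      proof -
        have "card {C \<in> G. B \<inter> C = {}} + card {C \<in> G. y \<in> C}
          = card ({C \<in> G. B \<inter> C = {}} \<union> {C \<in> G. y \<in> C})"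
          using fG y by (intro card_Un_disjoint[symmetric]) auto
        also have "\<dots> \<le> card G" using fG by (intro card_mono) auto
        finally show ?thesis .
      qed
      then show "card {i \<in> {1..s + b}. B \<inter> A i = {}} \<le> s - 1"
        using y cG eq assms(3) by (simp add: Y)
    qed
  qed
  then show "star1_rel n k (s + b) A s = {B \<in> star1 n k. B \<inter> core (s + b) A s \<noteq> {}}"
    by (auto simp: star1_rel_def Y_def)
qed

text \<open>The three parts are disjoint, since the \<open>A i\<close> avoid 1 and the
  \<open>F i\<close> lie outside \<open>star1_rel\<close> and differ from the \<open>A i\<close>.
  The first part is counted by \<open>card_star1_meeting\<close>.\<close>

lemma card_extremal_family:
  assumes "k \<ge> 1" "s \<ge> 1" "n \<ge> 1" "t \<ge> 1"
    and "A ` {1..s + b} \<subseteq> nsets {1..n} k" "inj_on A {1..s + b}" "inj_on F {1..t - 1}"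
    and "A ` {1..s + b} \<inter> F ` {1..t - 1} = {}" "1 \<notin> (\<Union>i\<in>{1..s + b}. A i)"
    and "card (core (s + b) A s) = core_bound k s b"
    and "\<forall>i\<in>{1..t - 1}. F i \<in> star1 n k - star1_rel n k (s + b) A s"
  shows "card (star1_rel n k (s + b) A s \<union> A ` {1..s + b} \<union> F ` {1..t - 1})
      + ((n - core_bound k s b - 1) choose (k - 1)) = ((n - 1) choose (k - 1)) + s + t + b - 1"
proof -
  note st = star1_rel_eq_meeting_core[OF assms(6,5,2,10)]
  have "core (s + b) A s \<subseteq> {1..n} - {1}"
    using st(2) assms(5,9) by (fastforce simp: nsets_def)
  then have c1: "card (star1_rel n k (s + b) A s) + ((n - core_bound k s b - 1) choose (k - 1))
      = (n - 1) choose (k - 1)"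
    using card_star1_meeting[of n k "core (s + b) A s"] assms by (simp add: st(1))
  have fin: "finite (star1_rel n k (s + b) A s)"
    using finite_nsets_interval by (simp add: star1_rel_def star1_def)
  have d: "star1_rel n k (s + b) A s \<inter> A ` {1..s + b} = {}"
    using assms(9) by (auto simp: star1_rel_def star1_def)
  have "card (star1_rel n k (s + b) A s \<union> A ` {1..s + b} \<union> F ` {1..t - 1})
    = card (star1_rel n k (s + b) A s \<union> A ` {1..s + b}) + card (F ` {1..t - 1})"
    using fin assms(8,11) by (intro card_Un_disjoint) auto
  also have "card (star1_rel n k (s + b) A s \<union> A ` {1..s + b})
    = card (star1_rel n k (s + b) A s) + card (A ` {1..s + b})"
    using fin d by (intro card_Un_disjoint) auto
  finally show ?thesis
    unfolding c1[symmetric] using assms(4) card_image[OF assms(6)] card_image[OF assms(7)]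
    by (simp add: ac_simps)
qed

section \<open>Union-intersecting families\<close>

text \<open>Enumerations of the disjoint families \<open>W\<close> and \<open>V\<close> are
  concatenated to one injective sequence, so later arguments can speak of subfamilies instead of
  sequences.\<close>

lemma union_intersectingD:
  assumes "union_intersecting s t \<F>" "W \<subseteq> \<F>" "V \<subseteq> \<F>" "finite W" "finite V"
    and "card W = s" "card V = t" "W \<inter> V = {}"
  shows "\<Union>W \<inter> \<Union>V \<noteq> {}"
proof -
  obtain f where f: "bij_betw f {1..s} W" using ex_bij_betw_nat_finite_1 assms by blast
  obtain g where g: "bij_betw g {1..t} V" using ex_bij_betw_nat_finite_1 assms by blast
  define A where "A i = (if i \<le> s then f i else g (i - s))" for i
  have A1: "A ` {1..s} = W" using f by (auto simp: A_def bij_betw_def)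
  have A2: "(\<lambda>i. A (s + i)) ` {1..t} = V" using g by (auto simp: A_def bij_betw_def)
  have im: "A ` {1..s + t} = W \<union> V"
  proof -
    have "(+) s ` {1..t} = {s + 1..s + t}" by (simp add: image_add_atLeastAtMost)
    then have "{1..s + t} = {1..s} \<union> (+) s ` {1..t}" by auto
    then have "A ` {1..s + t} = A ` {1..s} \<union> (\<lambda>i. A (s + i)) ` {1..t}"
      by (metis image_Un image_image)
    then show ?thesis using A1 A2 by simp
  qed
  have "card (A ` {1..s + t}) = card {1..s + t}"
    unfolding im using assms by (simp add: card_Un_disjoint)
  then have "inj_on A {1..s + t}" by (simp add: eq_card_imp_inj_on)
  then have "(\<Union>i\<in>{1..s}. A i) \<inter> (\<Union>i\<in>{1..t}. A (s + i)) \<noteq> {}"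
    using assms im unfolding union_intersecting_def by blast
  then show ?thesis unfolding A1 A2 .
qed

lemma union_intersecting_subset:
  assumes "union_intersecting s t \<F>" "\<G> \<subseteq> \<F>"
  shows "union_intersecting s t \<G>"
  unfolding union_intersecting_def
proof (intro allI impI, elim conjE)
  fix A assume "inj_on A {1..s + t}" "A ` {1..s + t} \<subseteq> \<G>"
  then have "inj_on A {1..s + t} \<and> A ` {1..s + t} \<subseteq> \<F>" using assms(2) by simp
  then show "(\<Union>i\<in>{1..s}. A i) \<inter> (\<Union>i\<in>{1..t}. A (s + i)) \<noteq> {}"
    by (rule assms(1)[unfolded union_intersecting_def, THEN spec, THEN mp])
qed

lemma union_intersecting_permute:
  assumes "union_intersecting s t \<F>" "bij \<pi>"
  shows "union_intersecting s t ((\<lambda>A. \<pi> ` A) ` \<F>)"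
  unfolding union_intersecting_def
proof (intro allI impI, elim conjE)
  fix A assume inj: "inj_on A {1..s + t}" and sub: "A ` {1..s + t} \<subseteq> (\<lambda>A. \<pi> ` A) ` \<F>"
  define A' where "A' i = inv \<pi> ` A i" for i
  have A_eq: "A i = \<pi> ` A' i" for i
    unfolding A'_def image_f_inv_f[OF bij_is_surj[OF assms(2)]] ..
  have 1: "inj_on A' {1..s + t}"
  proof (rule inj_onI)
    fix i j assume ij: "i \<in> {1..s + t}" "j \<in> {1..s + t}" "A' i = A' j"
    have "A i = A j" unfolding A_eq ij(3) ..
    then show "i = j" by (rule inj_onD[OF inj _ ij(1,2)])
  qed
  have "A' i \<in> \<F>" if i: "i \<in> {1..s + t}" for i
  proof -
    have "A i \<in> (\<lambda>A. \<pi> ` A) ` \<F>"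
      by (rule subsetD[OF sub imageI[OF i]])
    then obtain B where B: "A i = \<pi> ` B" "B \<in> \<F>" by (rule imageE)
    have "A' i = B"
      unfolding A'_def B(1) using assms(2) by (simp add: image_image bij_is_inj)
    then show "A' i \<in> \<F>" using B(2) by simp
  qed
  then have 2: "A' ` {1..s + t} \<subseteq> \<F>" by (rule image_subsetI)
  have "(\<Union>i\<in>{1..s}. A' i) \<inter> (\<Union>i\<in>{1..t}. A' (s + i)) \<noteq> {}"
    by (rule assms(1)[unfolded union_intersecting_def, THEN spec, THEN mp, OF conjI[OF 1 2]])
  then have "\<pi> ` ((\<Union>i\<in>{1..s}. A' i) \<inter> (\<Union>i\<in>{1..t}. A' (s + i))) \<noteq> {}" by (simp only: image_is_empty not_False_eq_True)
  then show "(\<Union>i\<in>{1..s}. A i) \<inter> (\<Union>i\<in>{1..t}. A (s + i)) \<noteq> {}"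
    unfolding image_Int[OF bij_is_inj[OF assms(2)]] image_UN A_eq[symmetric] .
qed

lemma ell_le:
  assumes "finite \<R>" "\<R> \<subseteq> \<F>" "intersecting (\<F> - \<R>)"
  shows "ell \<F> \<le> card \<R>"
  unfolding ell_def by (rule Least_le) (use assms in \<open>auto intro!: exI[of _ \<R>]\<close>)

lemma ell_le_avoiding:
  assumes "finite \<F>"
  shows "ell \<F> \<le> card {B \<in> \<F>. x \<notin> B}"
  by (rule ell_le) (use assms in \<open>auto simp: intersecting_def\<close>)

text \<open>Given two edges \<open>{x, y}\<close> and \<open>{x, z}\<close>, an edge avoiding
  \<open>x\<close> must be \<open>{y, z}\<close>; if it is present, every edge through
  \<open>x\<close> is one of the first two. This is the star-or-triangle dichotomy for
  graphs.\<close>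

lemma intersecting_pairs_cases:
  assumes "\<And>e. e \<in> H \<Longrightarrow> card e = 2" "\<And>e e'. e \<in> H \<Longrightarrow> e' \<in> H \<Longrightarrow> e \<inter> e' \<noteq> {}" "card H \<ge> 3"
  obtains x where "\<And>e. e \<in> H \<Longrightarrow> x \<in> e"
  | x y z where "x \<noteq> y" "y \<noteq> z" "x \<noteq> z" "H = {{x, y}, {x, z}, {y, z}}"
proof -
  obtain e1 e2 where e: "e1 \<in> H" "e2 \<in> H" "e1 \<noteq> e2"
  proof -
    have "2 \<le> card H" using assms(3) by simp
    then obtain H' where "H' \<subseteq> H" "card H' = 2" by (rule obtain_subset_with_card_n)
    then show ?thesis using that by (auto simp: card_2_iff)
  qed
  obtain x where x: "x \<in> e1" "x \<in> e2" using assms(2) e by blast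
  obtain y where y: "e1 = {x, y}" "x \<noteq> y"
    using assms(1)[OF e(1)] x by (auto simp: card_2_iff)
  obtain z where z: "e2 = {x, z}" "x \<noteq> z"
    using assms(1)[OF e(2)] x by (auto simp: card_2_iff)
  have yz: "y \<noteq> z" using e y z by auto
  show ?thesis
  proof (cases "\<forall>e\<in>H. x \<in> e")
    case True
    then show ?thesis using that(1) by blast
  next
    case False
    then obtain e3 where e3: "e3 \<in> H" "x \<notin> e3" by auto
    have no_x: "e' = {y, z}" if "e' \<in> H" "x \<notin> e'" for e'
    proof -
      have "y \<in> e'" "z \<in> e'" using that assms(2)[OF that(1)] e y z by blast+
      then show ?thesis using assms(1)[OF that(1)] yz by (auto simp: card_2_iff)
    qed
    have "e' = {x, y} \<or> e' = {x, z}" if "e' \<in> H" "x \<in> e'" for e'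
    proof -
      have "y \<in> e' \<or> z \<in> e'" using assms(2)[OF that(1) e3(1)] no_x[OF e3] by auto
      then show ?thesis using assms(1)[OF that(1)] that(2) y(2) z(2) by (auto simp: card_2_iff)
    qed
    then have "H = {{x, y}, {x, z}, {y, z}}" using no_x e e3 y z by blast
    then show ?thesis using that(2) yz y z by blast
  qed
qed

section \<open>Degrees and heavy pairs\<close>

text \<open>The locale is instantiated twice: by the given family, and by its image under a
  transposition that moves the centre of the star to 1.\<close>

locale union_intersecting_family =
  fixes n k s t :: nat and \<F> :: "nat set set"
  assumes family: "\<F> \<subseteq> nsets {1..n} k" and ui: "union_intersecting s t \<F>" and k: "k \<ge> 1"
begin

lemma fin: "finite \<F>"
  using finite_subfamily family .

lemma few_avoiding:
  assumes "W \<subseteq> \<F>" "card W = s"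
  shows "card {B \<in> \<F>. B \<inter> \<Union>W = {}} < t"
proof (rule ccontr)
  assume "\<not> ?thesis"
  then obtain V where V: "V \<subseteq> {B \<in> \<F>. B \<inter> \<Union>W = {}}" "card V = t" "finite V"
    by (meson linorder_not_le obtain_subset_with_card_n)
  \<comment> \<open>Members are nonempty since \<open>k \<ge> 1\<close>, so none can belong to
    \<open>W\<close> and be disjoint from \<open>\<Union>W\<close>.\<close>
  have "B \<noteq> {}" if "B \<in> \<F>" for B using that family k by (auto simp: nsets_def)
  then have "W \<inter> V = {}" using V by blast
  moreover have "finite W" using assms fin finite_subset by blast
  ultimately have "\<Union>W \<inter> \<Union>V \<noteq> {}"
    by (intro union_intersectingD[OF ui]) (use assms V in auto)
  then show False using V by blast
qed

lemma card_Union_le: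
  assumes "W \<subseteq> \<F>" "card W = s"
  shows "finite (\<Union>W)" "card (\<Union>W) \<le> s * k"
proof -
  have fW: "finite W" using assms fin finite_subset by blast
  moreover have "finite A \<and> card A = k" if "A \<in> W" for A
    using that assms family by (auto simp: nsets_def)
  ultimately show "finite (\<Union>W)" by auto
  have "card (\<Union>W) \<le> (\<Sum>A\<in>W. card A)"
    using fW by (intro card_Union_le_sum_card) 
  also have "\<dots> = s * k"
    using \<open>\<And>A. A \<in> W \<Longrightarrow> finite A \<and> card A = k\<close> assms by simp
  finally show "card (\<Union>W) \<le> s * k" .
qed

definition deg :: "nat set \<Rightarrow> nat" where
  "deg e = card {B \<in> \<F>. e \<subseteq> B}"

lemma deg_le: "deg e \<le> (n - card e) choose (k - card e)"
proof -
  have "deg e \<le> card {B \<in> nsets {1..n} k. e \<subseteq> B}"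
    unfolding deg_def using family finite_nsets_interval by (intro card_mono) auto
  also have "\<dots> \<le> (n - card e) choose (k - card e)"
    using card_nsets_superset_le[of "{1..n}"] by simp
  finally show ?thesis .
qed

text \<open>Each counted member contains a triple \<open>insert u e\<close> with \<open>u\<close> in
  \<open>U\<close>, and a triple lies in at most \<open>(n - 3) choose (k - 3)\<close>
  members.\<close>

lemma deg_meeting_le:
  assumes "finite U" "U \<inter> e = {}" "card e = 2"
  shows "card {B \<in> \<F>. e \<subseteq> B \<and> B \<inter> U \<noteq> {}} \<le> card U * ((n - 3) choose (k - 3))"
proof -
  have fe: "finite e" using assms(3) card.infinite by fastforce
  have "{B \<in> \<F>. e \<subseteq> B \<and> B \<inter> U \<noteq> {}} \<subseteq> (\<Union>u\<in>U. {B \<in> \<F>. insert u e \<subseteq> B})" by auto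
  then have "card {B \<in> \<F>. e \<subseteq> B \<and> B \<inter> U \<noteq> {}} \<le> card (\<Union>u\<in>U. {B \<in> \<F>. insert u e \<subseteq> B})"
    using fin assms(1) by (intro card_mono) auto
  also have "\<dots> \<le> (\<Sum>u\<in>U. deg (insert u e))"
    unfolding deg_def using assms(1) by (rule card_UN_le)
  also have "\<dots> \<le> (\<Sum>u\<in>U. (n - 3) choose (k - 3))"
  proof (rule sum_mono)
    fix u assume "u \<in> U"
    then have "u \<notin> e" using assms(2) by auto
    then have "card (insert u e) = 3" using assms(3) fe by simp
    then show "deg (insert u e) \<le> (n - 3) choose (k - 3)" using deg_le by metis
  qed
  finally show ?thesis by simp
qed

text \<open>If \<open>s\<close> members missed \<open>e\<close>, then of the members through
  \<open>e\<close> at most \<open>s * k * ((n - 3) choose (k - 3))\<close> would meet their union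
  and fewer than \<open>t\<close> would avoid it, contradicting the degree.\<close>

lemma few_missing_heavy:
  assumes e: "card e = 2" and "deg e \<ge> s * k * ((n - 3) choose (k - 3)) + t"
  shows "card {B \<in> \<F>. B \<inter> e = {}} < s"
proof (rule ccontr)
  assume "\<not> ?thesis"
  then obtain W where W: "W \<subseteq> {B \<in> \<F>. B \<inter> e = {}}" "card W = s"
    by (meson linorder_not_le obtain_subset_with_card_n)
  then have WF: "W \<subseteq> \<F>" by auto
  define U where "U = \<Union>W"
  have U: "finite U" "card U \<le> s * k" unfolding U_def using card_Union_le[OF WF W(2)] by auto
  have "{B \<in> \<F>. e \<subseteq> B} \<subseteq> {B \<in> \<F>. e \<subseteq> B \<and> B \<inter> U \<noteq> {}} \<union> {B \<in> \<F>. B \<inter> U = {}}" by auto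
  then have "deg e \<le> card ({B \<in> \<F>. e \<subseteq> B \<and> B \<inter> U \<noteq> {}} \<union> {B \<in> \<F>. B \<inter> U = {}})"
    unfolding deg_def using fin by (intro card_mono) auto
  also have "\<dots> \<le> card {B \<in> \<F>. e \<subseteq> B \<and> B \<inter> U \<noteq> {}} + card {B \<in> \<F>. B \<inter> U = {}}"
    by (rule card_Un_le)
  also have "\<dots> < card U * ((n - 3) choose (k - 3)) + t"
  proof (rule add_le_less_mono)
    show "card {B \<in> \<F>. e \<subseteq> B \<and> B \<inter> U \<noteq> {}} \<le> card U * ((n - 3) choose (k - 3))"
      by (rule deg_meeting_le) (use U W e in \<open>auto simp: U_def\<close>)
    show "card {B \<in> \<F>. B \<inter> U = {}} < t" unfolding U_def by (rule few_avoiding[OF WF W(2)])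
  qed
  also have "\<dots> \<le> s * k * ((n - 3) choose (k - 3)) + t" using U(2) by simp
  finally show False using assms(2) by simp
qed

text \<open>The summands \<open>s * k\<close> and \<open>t\<close> pay for
  \<open>few_missing_heavy\<close>, \<open>s\<close> and \<open>2\<close> for
  \<open>heavy_intersect\<close>. Additive constants are absorbed into the factor because the
  binomial coefficient is at least 1 where this matters.\<close>

definition threshold :: nat where
  "threshold = (s * k + s + t + 2) * ((n - 3) choose (k - 3))"

definition heavy :: "nat set set" where
  "heavy = {e. card e = 2 \<and> deg e \<ge> threshold}"

lemma few_missing:
  assumes "e \<in> heavy" "(n - 3) choose (k - 3) \<ge> 1"
  shows "card {B \<in> \<F>. B \<inter> e = {}} < s"
proof (rule few_missing_heavy)
  show "card e = 2" using assms by (simp add: heavy_def)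
  have "t \<le> (s + t + 2) * ((n - 3) choose (k - 3))"
    using mult_le_mono[of t "s + t + 2" 1 "(n - 3) choose (k - 3)"] assms(2) by simp
  then show "s * k * ((n - 3) choose (k - 3)) + t \<le> deg e"
    using assms(1) by (simp add: heavy_def threshold_def algebra_simps)
qed

text \<open>If \<open>e\<close> and \<open>e'\<close> were disjoint, fewer than \<open>s\<close>
  members through \<open>e'\<close> would miss \<open>e\<close>, and the others would contain one of
  two triples: too few for the threshold.\<close>

lemma heavy_intersect:
  assumes "e \<in> heavy" "e' \<in> heavy" "(n - 3) choose (k - 3) \<ge> 1"
  shows "e \<inter> e' \<noteq> {}"
proof
  assume dis: "e \<inter> e' = {}"
  have e: "card e = 2" "card e' = 2" "finite e"
    using assms card.infinite by (fastforce simp: heavy_def)+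
  have "deg e' \<le> card ({B \<in> \<F>. e' \<subseteq> B \<and> B \<inter> e \<noteq> {}} \<union> {B \<in> \<F>. B \<inter> e = {}})"
    unfolding deg_def using fin by (intro card_mono) auto
  also have "\<dots> \<le> card {B \<in> \<F>. e' \<subseteq> B \<and> B \<inter> e \<noteq> {}} + card {B \<in> \<F>. B \<inter> e = {}}"
    by (rule card_Un_le)
  also have "\<dots> < 2 * ((n - 3) choose (k - 3)) + s"
    using deg_meeting_le[of e e'] few_missing[OF assms(1,3)] e dis by simp
  also have "\<dots> \<le> 2 * ((n - 3) choose (k - 3)) + s * ((n - 3) choose (k - 3))"
    using assms(3) by simp
  also have "\<dots> \<le> threshold" by (simp add: threshold_def algebra_simps)
  finally show False using assms(2) by (simp add: heavy_def)
qed

lemma heavy_subset: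
  assumes "(n - 3) choose (k - 3) \<ge> 1"
  shows "heavy \<subseteq> Pow {1..n}"
proof
  fix e assume "e \<in> heavy"
  then have "deg e > 0" using assms by (auto simp: heavy_def threshold_def)
  then have "{B \<in> \<F>. e \<subseteq> B} \<noteq> {}" unfolding deg_def by (metis card.empty less_irrefl)
  then show "e \<in> Pow {1..n}" using family by (auto simp: nsets_def)
qed

lemma finite_heavy: "(n - 3) choose (k - 3) \<ge> 1 \<Longrightarrow> finite heavy"
  using heavy_subset finite_subset by blast

text \<open>Pick \<open>s\<close> members with
  union \<open>U\<close>, and for each \<open>x \<in> U\<close> pick \<open>s\<close> members avoiding \<open>x\<close>, with union \<open>V x\<close>. All but a bounded
  number of members contain a pair \<open>{x, y}\<close> with \<open>x \<in> U\<close> and \<open>y \<in> V x\<close>.\<close>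

lemma card_le_heavy:
  assumes "\<And>x. card {B \<in> \<F>. x \<notin> B} \<ge> s" "(n - 3) choose (k - 3) \<ge> 1"
  shows "card \<F> \<le> card heavy * ((n - 2) choose (k - 2))
    + (t + s * k * t + s * k * (s * k) * (s * k + s + t + 2)) * ((n - 3) choose (k - 3))"
proof -
  have "\<exists>W. W \<subseteq> {B \<in> \<F>. x \<notin> B} \<and> card W = s" for x
    using assms(1)[of x] by (meson obtain_subset_with_card_n)
  then obtain W where W: "\<And>x. W x \<subseteq> {B \<in> \<F>. x \<notin> B}" "\<And>x. card (W x) = s" by metis
  have WF: "W x \<subseteq> \<F>" for x using W(1) by blast
  define V where "V x = \<Union>(W x)" for x
  \<comment> \<open>The point 0 lies outside the ground set, so \<open>W 0\<close> is just some
    choice of \<open>s\<close> members.\<close>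
  define U where "U = V 0"
  have V: "finite (V x)" "card (V x) \<le> s * k" "x \<notin> V x" for x
    unfolding V_def using card_Union_le[OF WF W(2)] W(1)[of x] by auto
  define P where "P = Sigma U V"
  have cP: "card P \<le> s * k * (s * k)"
  proof -
    have "card P = (\<Sum>x\<in>U. card (V x))" unfolding P_def by (rule card_SigmaI) (use V U_def in auto)
    also have "\<dots> \<le> (\<Sum>x\<in>U. s * k)" by (rule sum_mono) (use V in auto)
    also have "\<dots> = card U * (s * k)" by simp
    also have "\<dots> \<le> s * k * (s * k)" using V(2)[of 0] by (intro mult_le_mono) (auto simp: U_def)
    finally show ?thesis .
  qed
  have fP: "finite P" using V by (auto simp: P_def U_def)
  \<comment> \<open>\<open>X1\<close> and \<open>X2\<close> hold the boundedly many exceptions,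
    \<open>X3\<close> the members through a pair of \<open>P\<close> that is not heavy and so has
    degree below \<open>threshold\<close>, and \<open>X4\<close> the members through any heavy
    pair.\<close>
  define X1 where "X1 = {B \<in> \<F>. B \<inter> U = {}}"
  define X2 where "X2 = (\<Union>x\<in>U. {B \<in> \<F>. B \<inter> V x = {}})"
  define X3 where "X3 = (\<Union>p\<in>{p \<in> P. {fst p, snd p} \<notin> heavy}. {B \<in> \<F>. {fst p, snd p} \<subseteq> B})"
  define X4 where "X4 = (\<Union>e\<in>heavy. {B \<in> \<F>. e \<subseteq> B})"
  have "\<F> \<subseteq> X1 \<union> X2 \<union> X3 \<union> X4"
  proof
    fix B assume B: "B \<in> \<F>"
    show "B \<in> X1 \<union> X2 \<union> X3 \<union> X4"
    proof (rule ccontr)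
      assume no: "B \<notin> X1 \<union> X2 \<union> X3 \<union> X4"
      then obtain x where x: "x \<in> B" "x \<in> U" using B by (auto simp: X1_def)
      then obtain y where y: "y \<in> B" "y \<in> V x" using B no by (auto simp: X2_def)
      then have "(x, y) \<in> P" using x by (auto simp: P_def)
      then have "B \<in> X3" if "{x, y} \<notin> heavy"
        unfolding X3_def using that B x(1) y(1) by (intro UN_I[of "(x, y)"]) auto
      moreover have "B \<in> X4" if "{x, y} \<in> heavy"
        unfolding X4_def using that B x(1) y(1) by (intro UN_I[of "{x, y}"]) auto
      ultimately show False using no by blast
    qed
  qed
  then have "card \<F> \<le> card (X1 \<union> X2 \<union> X3 \<union> X4)"
  proof (rule card_mono[rotated])
    show "finite (X1 \<union> X2 \<union> X3 \<union> X4)"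
    proof (rule finite_subset[OF _ fin])
      have "X1 \<subseteq> \<F>" "X2 \<subseteq> \<F>" "X3 \<subseteq> \<F>" "X4 \<subseteq> \<F>"
        unfolding X1_def X2_def X3_def X4_def by (simp_all add: UN_subset_iff)
      then show "X1 \<union> X2 \<union> X3 \<union> X4 \<subseteq> \<F>" by simp
    qed
  qed
  also have "\<dots> \<le> card X1 + card X2 + card X3 + card X4"
    by (meson add_le_mono card_Un_le le_refl le_trans)
  finally have 0: "card \<F> \<le> card X1 + card X2 + card X3 + card X4" .
  have 1: "card X1 \<le> t"
    unfolding X1_def U_def V_def by (rule less_imp_le, rule few_avoiding[OF WF W(2)])
  have "card X2 \<le> (\<Sum>x\<in>U. card {B \<in> \<F>. B \<inter> V x = {}})"
    unfolding X2_def using V by (intro card_UN_le) (simp add: U_def)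
  also have "\<dots> \<le> (\<Sum>x\<in>U. t)"
    by (rule sum_mono) (simp add: V_def, rule less_imp_le, rule few_avoiding[OF WF W(2)])
  also have "\<dots> \<le> s * k * t" using V(2)[of 0] by (simp add: U_def)
  finally have 2: "card X2 \<le> s * k * t" .
  have "card X3 \<le> (\<Sum>p\<in>{p \<in> P. {fst p, snd p} \<notin> heavy}. deg {fst p, snd p})"
    unfolding X3_def deg_def using fP by (intro card_UN_le) simp
  also have "\<dots> \<le> (\<Sum>p\<in>{p \<in> P. {fst p, snd p} \<notin> heavy}. threshold)"
  proof (rule sum_mono)
    fix p assume p: "p \<in> {p \<in> P. {fst p, snd p} \<notin> heavy}"
    then have "fst p \<noteq> snd p" using V(3) by (auto simp: P_def)
    then have "card {fst p, snd p} = 2" by simp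
    then show "deg {fst p, snd p} \<le> threshold" using p by (simp add: heavy_def)
  qed
  also have "\<dots> \<le> card P * threshold" using fP by (auto intro!: card_mono)
  also have "\<dots> \<le> s * k * (s * k) * threshold" using cP by simp
  finally have 3: "card X3 \<le> s * k * (s * k) * threshold" .
  have "card X4 \<le> (\<Sum>e\<in>heavy. deg e)"
    unfolding X4_def deg_def using finite_heavy[OF assms(2)] by (intro card_UN_le)
  also have "\<dots> \<le> (\<Sum>e\<in>heavy. (n - 2) choose (k - 2))"
  proof (rule sum_mono)
    fix e assume "e \<in> heavy"
    then have "card e = 2" by (simp add: heavy_def)
    then show "deg e \<le> (n - 2) choose (k - 2)" using deg_le by metis
  qed
  finally have 4: "card X4 \<le> card heavy * ((n - 2) choose (k - 2))" by simp
  define D where "D = (n - 3) choose (k - 3)"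
  have "t + s * k * t \<le> (t + s * k * t) * D" using assms(2) unfolding D_def[symmetric]
    by (rule mult_le_mono2[of 1 _ "t + s * k * t", unfolded mult_1_right])
  then have 5: "t + s * k * t + s * k * (s * k) * threshold
    \<le> (t + s * k * t + s * k * (s * k) * (s * k + s + t + 2)) * D"
    unfolding threshold_def D_def[symmetric] add_mult_distrib[of "t + s * k * t"]
      mult.assoc[of "s * k * (s * k)"] by (rule add_right_mono)
  have "card \<F> \<le> t + s * k * t + s * k * (s * k) * threshold
      + card heavy * ((n - 2) choose (k - 2))"
    by (rule order_trans[OF 0]) (intro add_mono 1 2 3 4)
  also have "\<dots> \<le> (t + s * k * t + s * k * (s * k) * (s * k + s + t + 2)) * D
      + card heavy * ((n - 2) choose (k - 2))"
    using 5 by (rule add_right_mono)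
  finally show ?thesis unfolding D_def by (simp only: add.commute)
qed

text \<open>With \<open>C\<close>, \<open>D\<close>, \<open>K\<close> as in the proof, the size
  hypothesis and \<open>binomial_shift_ge\<close> give at least \<open>m * C - m\<^sup>2 * D\<close>
  members, whereas fewer than \<open>m\<close> heavy pairs allow at most
  \<open>(m - 1) * C + K * D\<close> by \<open>card_le_heavy\<close>. Then
  \<open>C \<le> (K + m\<^sup>2) * D\<close>, which is false for large \<open>n\<close>.\<close>

lemma many_heavy:
  assumes "k \<ge> 3" "\<And>x. card {B \<in> \<F>. x \<notin> B} \<ge> s" "n \<ge> k" "m + 1 < n"
    and "(n - 1) choose (k - 1) \<le> card \<F> + ((n - m - 1) choose (k - 1))"
    and "n > (k - 2) * (t + s * k * t + s * k * (s * k) * (s * k + s + t + 2) + m\<^sup>2) + 2"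
  shows "m \<le> card heavy"
proof (rule ccontr)
  define D where "D = (n - 3) choose (k - 3)"
  define C where "C = (n - 2) choose (k - 2)"
  define X where "X = (n - 1) choose (k - 1)"
  define Z where "Z = (n - m - 1) choose (k - 1)"
  define K where "K = t + s * k * t + s * k * (s * k) * (s * k + s + t + 2)"
  assume "\<not> ?thesis"
  then have "(card heavy + 1) * C \<le> m * C" by (intro mult_le_mono1) simp
  then have h: "card heavy * C + C \<le> m * C" by simp
  have D: "D \<ge> 1" using assms(1,3) by (simp add: D_def Suc_le_eq)
  have 1: "card \<F> \<le> card heavy * C + K * D"
    using card_le_heavy[OF assms(2) D[unfolded D_def]] unfolding C_def D_def K_def .
  have 2: "Z + m * C \<le> X + m\<^sup>2 * D"
  proof -
    have eqs: "n - 1 - m = n - m - 1" "n - 1 - 1 = n - 2" "n - 1 - 2 = n - 3"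
      "k - 1 - 1 = k - 2" "k - 1 - 2 = k - 3" by auto
    have "k - 1 \<ge> 2" "m < n - 1" using assms(1,4) by auto
    then show ?thesis
      using binomial_shift_ge[of "k - 1" m "n - 1"] by (simp only: C_def D_def X_def Z_def eqs)
  qed
  have "X \<le> card \<F> + Z" using assms(5) unfolding X_def Z_def .
  then have "C \<le> K * D + m\<^sup>2 * D" using 1 2 h by linarith
  then have "C \<le> (K + m\<^sup>2) * D" by (simp only: add_mult_distrib)
  then have "(k - 2) * C \<le> (k - 2) * ((K + m\<^sup>2) * D)" by (rule mult_le_mono2)
  \<comment> \<open>By absorption, \<open>C / D\<close> grows linearly in \<open>n\<close>; this
    dictates the lower bound assumed for \<open>n\<close>.\<close>
  moreover have "(k - 2) * C = (n - 2) * D"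
  proof -
    obtain k' where "k = 3 + k'" using assms(1) le_Suc_ex by blast
    then have k': "k - 2 = Suc k'" "k - 3 = k'" by auto
    have n3: "n - 2 - 1 = n - 3" by simp
    show ?thesis
      using binomial_absorption[of k' "n - 2"] unfolding C_def D_def k' n3 .
  qed
  moreover define L where "L = (k - 2) * (K + m\<^sup>2)"
  ultimately have "(n - 2) * D \<le> L * D" by (simp only: mult.assoc)
  then have "n - 2 \<le> L" using D unfolding mult_le_cancel2 by linarith
  moreover have "L + 2 < n" using assms(6) unfolding L_def K_def .
  ultimately show False by linarith
qed

section \<open>The shape of the heavy pairs\<close>

text \<open>A member missing none of the three pairs contains at least two of \<open>x\<close>,
  \<open>y\<close>, \<open>z\<close>, and two such members share one of these points. So it is
  enough to delete the members that miss a pair, at most \<open>s - 1\<close> for each.\<close>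

lemma ell_le_triangle:
  assumes "{x, y} \<in> heavy" "{x, z} \<in> heavy" "{y, z} \<in> heavy" "(n - 3) choose (k - 3) \<ge> 1"
  shows "ell \<F> \<le> 3 * (s - 1)"
proof -
  define M where "M e = {B \<in> \<F>. B \<inter> e = {}}" for e :: "nat set"
  have M: "card (M e) \<le> s - 1" if "e \<in> heavy" for e
    using few_missing[OF that assms(4)] by (simp add: M_def)
  have "ell \<F> \<le> card (M {x, y} \<union> M {x, z} \<union> M {y, z})"
    by (rule ell_le) (use fin in \<open>auto simp: M_def intersecting_def\<close>)
  also have "\<dots> \<le> card (M {x, y}) + card (M {x, z}) + card (M {y, z})"
    by (meson add_le_mono card_Un_le le_refl le_trans)
  also have "\<dots> \<le> 3 * (s - 1)" using M[OF assms(1)] M[OF assms(2)] M[OF assms(3)] by linarith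
  finally show ?thesis .
qed

text \<open>From here on the heavy pairs are forgotten: what is kept is a centre \<open>x\<close>,
  its leaves \<open>Y\<close>, and that fewer than \<open>s\<close> members avoid both
  \<open>x\<close> and a given leaf.\<close>

lemma obtain_center:
  assumes "k \<ge> 3" "s \<ge> 1" "ell \<F> \<ge> s + \<beta>" and m: "m = core_bound k s \<beta>"
    and "n \<ge> k" "m + 1 < n" "(n - 1) choose (k - 1) \<le> card \<F> + ((n - m - 1) choose (k - 1))"
    and "n > (k - 2) * (t + s * k * t + s * k * (s * k) * (s * k + s + t + 2) + m\<^sup>2) + 2"
  obtains x Y where "x \<in> {1..n}" "Y \<subseteq> {1..n} - {x}" "m \<le> card Y"
    "\<And>y. y \<in> Y \<Longrightarrow> card {B \<in> \<F>. x \<notin> B \<and> y \<notin> B} < s"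
proof -
  have D: "(n - 3) choose (k - 3) \<ge> 1" using assms by (simp add: Suc_le_eq)
  have avoid: "s \<le> card {B \<in> \<F>. x \<notin> B}" for x
    using ell_le_avoiding[OF fin, of x] assms(3) by linarith
  have h: "m \<le> card heavy" using many_heavy[OF assms(1) avoid assms(5-8)] .
  have mk: "k \<le> m" using assms(2) by (simp add: m core_bound_alt)
  show thesis
  proof (rule intersecting_pairs_cases[of heavy])
    show "card e = 2" if "e \<in> heavy" for e using that by (simp add: heavy_def)
    show "e \<inter> e' \<noteq> {}" if "e \<in> heavy" "e' \<in> heavy" for e e' using heavy_intersect that D by blast
    show "3 \<le> card heavy" using h mk assms(1) by linarith
  next
    fix x assume x: "\<And>e. e \<in> heavy \<Longrightarrow> x \<in> e"
    define Y where "Y = {y. {x, y} \<in> heavy}"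
    have "heavy \<noteq> {}" using h mk assms(1) by auto
    then have xn: "x \<in> {1..n}" using x heavy_subset[OF D] by blast
    have Yn: "Y \<subseteq> {1..n} - {x}" using heavy_subset[OF D] by (auto simp: Y_def heavy_def)
    have "heavy \<subseteq> (\<lambda>y. {x, y}) ` Y"
    proof
      fix e assume e: "e \<in> heavy"
      then have "card e = 2" "x \<in> e" using x by (auto simp: heavy_def)
      then obtain y where "e = {x, y}" by (auto simp: card_2_iff)
      then show "e \<in> (\<lambda>y. {x, y}) ` Y" using e by (auto simp: Y_def)
    qed
    moreover have "finite Y" using Yn finite_subset by blast
    ultimately have "card heavy \<le> card Y" by (meson surj_card_le)
    then have "m \<le> card Y" using h by linarith
    moreover have "card {B \<in> \<F>. x \<notin> B \<and> y \<notin> B} < s" if "y \<in> Y" for y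
    proof -
      have "{B \<in> \<F>. x \<notin> B \<and> y \<notin> B} = {B \<in> \<F>. B \<inter> {x, y} = {}}" by auto
      then show ?thesis using few_missing[of "{x, y}"] that D by (simp add: Y_def)
    qed
    ultimately show thesis using that xn Yn by blast
  next
    fix x y z :: nat
    assume H: "heavy = {{x, y}, {x, z}, {y, z}}"
    \<comment> \<open>A triangle leaves only \<open>m = k = 3\<close>. Then
      \<open>3 * (s - 1) \<le> \<beta>\<close>, so \<open>ell_le_triangle\<close> gives
      \<open>ell \<F> \<le> \<beta>\<close>, contrary to
      \<open>ell \<F> \<ge> s + \<beta>\<close>.\<close>
    have "card heavy \<le> 3" unfolding H by (simp add: card_insert_if)
    then have k3: "k = 3" "m = k" using h mk assms(1) by auto
    then have "(s - 1) * k div (\<beta> + 1) = 0" using assms(2) by (simp add: m core_bound_alt)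
    then have "(s - 1) * k < \<beta> + 1" by (simp add: div_eq_0_iff)
    moreover have "ell \<F> \<le> 3 * (s - 1)" using ell_le_triangle[of x y z] H D by auto
    ultimately show thesis using assms(2,3) k3 by simp
  qed
qed

section \<open>Exact counting around the centre 1\<close>

text \<open>The family splits into \<open>S\<close>, through 1 and meeting \<open>Y\<close>,
  \<open>G\<close>, avoiding 1, and \<open>R\<close>, through 1 and missing \<open>Y\<close>. Their
  sizes are at most \<open>card S'\<close>, \<open>s + bh\<close> and \<open>t - 1\<close>, and
  equality in the total forces equality in each.\<close>

lemma star_case:
  assumes "s \<ge> 1" "n \<ge> 1" and Y: "Y \<subseteq> {1..n} - {1}" "core_bound k s \<beta> \<le> card Y"
    "\<And>y. y \<in> Y \<Longrightarrow> card {B \<in> \<F>. 1 \<notin> B \<and> y \<notin> B} < s"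
    and "s + \<beta> \<le> card {B \<in> \<F>. 1 \<notin> B}"
  defines "m \<equiv> core_bound k s \<beta>" and "bh \<equiv> beta_hat k s \<beta>"
  shows "card \<F> + ((n - m - 1) choose (k - 1)) < ((n - 1) choose (k - 1)) + s + t + bh"
    and "card \<F> + ((n - m - 1) choose (k - 1)) + 1 = ((n - 1) choose (k - 1)) + s + t + bh \<Longrightarrow>
      \<exists>A F. A ` {1..s + bh} \<subseteq> nsets {1..n} k \<and> F ` {1..t - 1} \<subseteq> nsets {1..n} k \<and>
         inj_on A {1..s + bh} \<and> inj_on F {1..t - 1} \<and>
         A ` {1..s + bh} \<inter> F ` {1..t - 1} = {} \<and>
         1 \<notin> (\<Union>i\<in>{1..s + bh}. A i) \<and>
         card (core (s + bh) A s) = m \<and>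
         (\<forall>i\<in>{1..t - 1}. F i \<in> star1 n k - star1_rel n k (s + bh) A s) \<and>
         union_intersecting s t (A ` {1..s + bh} \<union> F ` {1..t - 1}) \<and>
         \<F> = star1_rel n k (s + bh) A s \<union> A ` {1..s + bh} \<union> F ` {1..t - 1}" (is "_ \<Longrightarrow> ?extremal")
proof -
  define G where "G = {B \<in> \<F>. 1 \<notin> B}"
  define b where "b = card G - s"
  have fG: "finite G" using fin by (simp add: G_def)
  have fY: "finite Y" using Y(1) finite_subset by blast
  have cG: "card G = s + b" "\<beta> \<le> b" using assms(6) by (auto simp: b_def G_def)
  have Gk: "finite A \<and> card A = k" if "A \<in> G" for A
    using that family by (auto simp: G_def nsets_def)
  have miss: "card {A \<in> G. y \<notin> A} \<le> s - 1" if "y \<in> Y" for y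
  proof -
    have "{A \<in> G. y \<notin> A} = {B \<in> \<F>. 1 \<notin> B \<and> y \<notin> B}" by (auto simp: G_def)
    then show ?thesis using Y(3)[OF that] by simp
  qed
  have hit: "b + 1 \<le> card {A \<in> G. y \<in> A}" if "y \<in> Y" for y
  proof -
    have "G = {A \<in> G. y \<in> A} \<union> {A \<in> G. y \<notin> A}" by auto
    then have "card G \<le> card {A \<in> G. y \<in> A} + card {A \<in> G. y \<notin> A}" by (metis card_Un_le)
    then show ?thesis using miss[OF that] cG assms(1) by linarith
  qed
  have le: "card Y \<le> core_bound k s b"
    by (rule core_size_bound(1)[OF fG fY cG(1)]) (use Gk hit in auto)
  \<comment> \<open>The chain \<open>m \<le> card Y \<le> core_bound k s b \<le> core_bound k s
    \<beta> = m\<close> collapses.\<close>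
  then have cY: "card Y = m" "core_bound k s b = m"
    using core_bound_antimono[OF assms(1) cG(2), of k] Y(2) by (auto simp: m_def)
  have cY': "card Y = core_bound k s b" using cY by simp
  \<comment> \<open>For \<open>m > k\<close> this is the maximality of \<open>bh\<close>. For
    \<open>m = k\<close>, where \<open>bh = \<beta>\<close>, it follows from
    \<open>card_le_of_core_card_eq\<close> and \<open>(s - 1) * k \<le> \<beta>\<close>.\<close>
  have bb: "b \<le> bh"
  proof (cases "m > k")
    case True
    then show ?thesis unfolding bh_def by (intro le_beta_hat) (use assms(1) cY in \<open>auto simp: m_def\<close>)
  next
    case False
    then have mk: "m = k" "(s - 1) * k div (\<beta> + 1) = 0"
      using assms(1) by (auto simp: m_def core_bound_alt)
    then have "(s - 1) * k \<le> \<beta>" by (simp add: div_eq_0_iff)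
    moreover have "s + b \<le> 1 + k * (s - 1)"
      by (rule card_le_of_core_card_eq[OF fG cG(1) Gk k assms(1) fY])
        (use cY mk miss in auto)
    ultimately have "b \<le> \<beta>" using assms(1) by (simp add: mult.commute)
    moreover have "bh = \<beta>" using mk by (simp add: bh_def beta_hat_def m_def)
    ultimately show ?thesis by simp
  qed
  have few_out: "card {A \<in> G. \<not> A \<subseteq> Y} \<le> b" "s \<le> card {A \<in> G. A \<subseteq> Y}"
    using few_outside_core[OF fG fY cG(1) Gk hit cY'] by auto
  \<comment> \<open>Every member of \<open>R\<close> misses these \<open>s\<close> sets inside
    \<open>Y\<close>, so \<open>few_avoiding\<close> bounds \<open>R\<close>.\<close>
  obtain W where W: "W \<subseteq> {A \<in> G. A \<subseteq> Y}" "card W = s"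
    using few_out(2) by (rule obtain_subset_with_card_n)
  define R where "R = {B \<in> \<F>. 1 \<in> B \<and> B \<inter> Y = {}}"
  define S where "S = {B \<in> \<F>. 1 \<in> B \<and> B \<inter> Y \<noteq> {}}"
  define S' where "S' = {B \<in> star1 n k. B \<inter> Y \<noteq> {}}"
  have cR: "card R < t"
  proof -
    have "card R \<le> card {B \<in> \<F>. B \<inter> \<Union>W = {}}"
      using fin W(1) by (intro card_mono) (auto simp: R_def)
    also have "\<dots> < t" by (rule few_avoiding[OF _ W(2)]) (use W(1) in \<open>auto simp: G_def\<close>)
    finally show ?thesis .
  qed
  have fS': "finite S'" using finite_nsets_interval by (simp add: S'_def star1_def)
  have SS': "S \<subseteq> S'" using family by (auto simp: S_def S'_def star1_def)
  have cS: "card S \<le> card S'" using fS' SS' by (rule card_mono)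
  have cS': "card S' + ((n - m - 1) choose (k - 1)) = (n - 1) choose (k - 1)"
    using card_star1_meeting[OF assms(2) k Y(1)] cY by (simp add: S'_def)
  have F_eq: "\<F> = S \<union> G \<union> R" by (auto simp: S_def G_def R_def)
  have "card (S \<union> G \<union> R) = card (S \<union> G) + card R"
    using fin by (intro card_Un_disjoint) (auto simp: S_def G_def R_def)
  also have "card (S \<union> G) = card S + card G"
    using fin by (intro card_Un_disjoint) (auto simp: S_def G_def)
  finally have cF: "card \<F> = card S + (s + b) + card R" using F_eq cG by simp
  show "card \<F> + ((n - m - 1) choose (k - 1)) < ((n - 1) choose (k - 1)) + s + t + bh"
    using cF cS cS' cR bb by linarith
  assume "card \<F> + ((n - m - 1) choose (k - 1)) + 1 = ((n - 1) choose (k - 1)) + s + t + bh"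
  then have bbh: "b = bh" and "card S = card S'" and cR': "card R = t - 1"
    using cF cS cS' cR bb by linarith+
  then have S_eq: "S = S'" using card_subset_eq[OF fS' SS'] by simp
  obtain A where A: "bij_betw A {1..s + bh} G"
    using ex_bij_betw_nat_finite_1[OF fG] cG bbh by auto
  have "finite R" using fin by (simp add: R_def)
  then obtain F where F: "bij_betw F {1..t - 1} R"
    using ex_bij_betw_nat_finite_1[of R] cR' by auto
  have A': "inj_on A {1..s + bh}" "A ` {1..s + bh} = G" using A by (auto simp: bij_betw_def)
  have F': "inj_on F {1..t - 1}" "F ` {1..t - 1} = R" using F by (auto simp: bij_betw_def)
  \<comment> \<open>A point outside \<open>Y\<close> lies only in those sets of \<open>G\<close>
    that are not inside \<open>Y\<close>. There are at most \<open>b\<close> of these, one short of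
    what \<open>core\<close> demands.\<close>
  have core: "core (s + bh) A s = Y"
  proof -
    have "x \<in> Y" if "b + 1 \<le> card {B \<in> G. x \<in> B}" for x
    proof (rule ccontr)
      assume "x \<notin> Y"
      then have "card {B \<in> G. x \<in> B} \<le> card {A \<in> G. \<not> A \<subseteq> Y}"
        using fG by (intro card_mono) auto
      then show False using that few_out(1) by linarith
    qed
    then show ?thesis using hit unfolding core_eq[OF A'(1)] A'(2) bbh by blast
  qed
  have sub: "G \<subseteq> nsets {1..n} k" "R \<subseteq> nsets {1..n} k" using family by (auto simp: G_def R_def)
  have star: "star1_rel n k (s + bh) A s = S'"
    using star1_rel_eq_meeting_core(1)[OF A'(1) _ assms(1)] core A'(2) sub(1) cY bbh
    by (simp add: S'_def)
  have "R \<subseteq> star1 n k - S'" using sub by (auto simp: R_def S'_def star1_def)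
  then have "\<forall>i\<in>{1..t - 1}. F i \<in> star1 n k - star1_rel n k (s + bh) A s"
    unfolding star using F'(2) by blast
  moreover have "\<forall>B\<in>G. 1 \<notin> B" by (simp add: G_def)
  moreover have "union_intersecting s t (G \<union> R)"
    by (rule union_intersecting_subset[OF ui]) (auto simp: G_def R_def)
  moreover have "G \<inter> R = {}" by (auto simp: G_def R_def)
  ultimately show ?extremal
    using A' F' sub core cY star F_eq S_eq by - (rule exI[of _ A], rule exI[of _ F], simp)
qed

end

section \<open>Moving the centre to 1\<close>

theorem theorem1:
  fixes k s t \<beta> :: nat
  assumes "k \<ge> 3" and "t \<ge> s" and "s \<ge> 1"
  defines "m \<equiv> core_bound k s \<beta>" and "bh \<equiv> beta_hat k s \<beta>"
  shows "\<exists>N. \<forall>n\<ge>N. \<forall>\<F>. \<F> \<subseteq> nsets {1..n} k \<longrightarrow> union_intersecting s t \<F> \<longrightarrow> ell \<F> \<ge> s + \<beta> \<longrightarrow>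
     int (card \<F>) \<le> int ((n - 1) choose (k - 1)) - int ((n - m - 1) choose (k - 1))
                      + int s + int t + int bh - 1 \<and>
     (int (card \<F>) = int ((n - 1) choose (k - 1)) - int ((n - m - 1) choose (k - 1))
                      + int s + int t + int bh - 1 \<longleftrightarrow>
      (\<exists>(A :: nat \<Rightarrow> nat set) (F :: nat \<Rightarrow> nat set).
         A ` {1..s + bh} \<subseteq> nsets {1..n} k \<and> F ` {1..t - 1} \<subseteq> nsets {1..n} k \<and>
         inj_on A {1..s + bh} \<and> inj_on F {1..t - 1} \<and>
         A ` {1..s + bh} \<inter> F ` {1..t - 1} = {} \<and>
         1 \<notin> (\<Union>i\<in>{1..s + bh}. A i) \<and>
         card (core (s + bh) A s) = m \<and>
         (\<forall>i\<in>{1..t - 1}. F i \<in> star1 n k - star1_rel n k (s + bh) A s) \<and>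
         union_intersecting s t (A ` {1..s + bh} \<union> F ` {1..t - 1}) \<and>
         isomorphic_families n \<F>
           (star1_rel n k (s + bh) A s \<union> A ` {1..s + bh} \<union> F ` {1..t - 1})))"
proof -
  define K where "K = (k - 2) * (t + s * k * t + s * k * (s * k) * (s * k + s + t + 2) + m\<^sup>2)"
  \<comment> \<open>The summands ensure \<open>n > K + 2\<close>, as \<open>many_heavy\<close>
    requires, together with \<open>n \<ge> k\<close> and \<open>m + 1 < n\<close>.\<close>
  define N where "N = K + 3 + k + m"
  show ?thesis
  proof (rule exI[of _ N], intro allI impI)
    fix n \<F>
    assume n: "n \<ge> N" and family: "\<F> \<subseteq> nsets {1..n} k" and ui: "union_intersecting s t \<F>"
      and ell: "s + \<beta> \<le> ell \<F>"
    have n1: "n \<ge> 1" "n \<ge> k" "m + 1 < n" using n by (auto simp: N_def)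
    interpret union_intersecting_family n k s t \<F>
      by unfold_locales (use family ui assms(1) in auto)
    define X where "X = (n - 1) choose (k - 1)"
    define Z where "Z = (n - m - 1) choose (k - 1)"
    let ?struct = "\<lambda>(A :: nat \<Rightarrow> nat set) (F :: nat \<Rightarrow> nat set).
         A ` {1..s + bh} \<subseteq> nsets {1..n} k \<and> F ` {1..t - 1} \<subseteq> nsets {1..n} k \<and>
         inj_on A {1..s + bh} \<and> inj_on F {1..t - 1} \<and>
         A ` {1..s + bh} \<inter> F ` {1..t - 1} = {} \<and>
         1 \<notin> (\<Union>i\<in>{1..s + bh}. A i) \<and>
         card (core (s + bh) A s) = m \<and>
         (\<forall>i\<in>{1..t - 1}. F i \<in> star1 n k - star1_rel n k (s + bh) A s) \<and>
         union_intersecting s t (A ` {1..s + bh} \<union> F ` {1..t - 1})"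
    let ?fam = "\<lambda>(A :: nat \<Rightarrow> nat set) (F :: nat \<Rightarrow> nat set).
         star1_rel n k (s + bh) A s \<union> A ` {1..s + bh} \<union> F ` {1..t - 1}"
    have bound: "core_bound k s bh = m" by (simp add: m_def bh_def core_bound_beta_hat)
    \<comment> \<open>The converse half of the characterization is a count, since isomorphic
      families have the same size.\<close>
    have size: "card \<F> + Z + 1 = X + s + t + bh"
      if st: "?struct A F" and iso: "isomorphic_families n \<F> (?fam A F)" for A F
    proof -
      obtain \<pi> where \<pi>: "\<pi> permutes {1..n}" "(\<lambda>A. \<pi> ` A) ` \<F> = ?fam A F"
        using iso by (auto simp: isomorphic_families_def)
      have "inj_on (\<lambda>A. \<pi> ` A) \<F>"
        using permutes_inj[OF \<pi>(1)] by (auto simp: inj_on_def inj_image_eq_iff)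
      then have "card \<F> = card (?fam A F)" using \<pi>(2) by (metis card_image)
      moreover have "card (?fam A F) + Z = X + s + t + bh - 1"
        unfolding X_def Z_def bound[symmetric]
        by (rule card_extremal_family) (use st assms(1-3) n1 bound in auto)
      ultimately show ?thesis using assms(3) by linarith
    qed
    have main: "card \<F> + Z < X + s + t + bh \<and> (card \<F> + Z + 1 = X + s + t + bh \<longrightarrow>
      (\<exists>A F. ?struct A F \<and> isomorphic_families n \<F> (?fam A F)))"
    \<comment> \<open>A family with fewer than \<open>X - Z\<close> members stays strictly below the
      bound because \<open>s \<ge> 1\<close>; only larger ones need the structural argument.\<close>
    proof (cases "card \<F> + Z < X")
      case False
      then have large: "X \<le> card \<F> + Z" by simp
      have m: "m = core_bound k s \<beta>" by (simp add: m_def)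
      have "n > K + 2" using n by (simp add: N_def)
      then obtain x Y where xY: "x \<in> {1..n}" "Y \<subseteq> {1..n} - {x}" "m \<le> card Y"
        "\<And>y. y \<in> Y \<Longrightarrow> card {B \<in> \<F>. x \<notin> B \<and> y \<notin> B} < s"
        using obtain_center[OF assms(1,3) ell m n1(2,3) large[unfolded X_def Z_def]]
        unfolding K_def by blast
      \<comment> \<open>This carries the centre to 1; it is the identity if
        \<open>x = 1\<close>.\<close>
      define \<pi> where "\<pi> = Transposition.transpose x 1"
      have \<pi>: "\<pi> permutes {1..n}" unfolding \<pi>_def by (rule permutes_swap_id) (use xY n1 in auto)
      have bij: "bij \<pi>" and inj: "inj \<pi>" using \<pi> by (simp_all add: permutes_bij permutes_inj)
      have px: "1 = \<pi> x" by (simp add: \<pi>_def)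
      have mem: "\<pi> z \<in> \<pi> ` B \<longleftrightarrow> z \<in> B" for z B using inj by (simp add: inj_image_mem_iff)
      have mem1: "1 \<in> \<pi> ` B \<longleftrightarrow> x \<in> B" for B using mem[of x B] px by metis
      define \<G> where "\<G> = (\<lambda>A. \<pi> ` A) ` \<F>"
      have inj\<F>: "inj_on (\<lambda>A. \<pi> ` A) \<F>"
        using inj by (auto simp: inj_on_def inj_image_eq_iff)
      have card\<G>: "card \<G> = card \<F>" unfolding \<G>_def using inj\<F> by (rule card_image)
      have count: "card {B \<in> \<G>. P B} = card {B \<in> \<F>. P (\<pi> ` B)}" for P
        unfolding \<G>_def by (rule card_index_set[OF inj\<F>, symmetric])
      interpret G: union_intersecting_family n k s t \<G>
      proof
        show "union_intersecting s t \<G>"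
          unfolding \<G>_def by (rule union_intersecting_permute[OF ui bij])
        have "\<pi> ` B \<in> nsets {1..n} k" if "B \<in> \<F>" for B
        proof -
          have "B \<subseteq> {1..n}" "finite B" "card B = k" using that family by (auto simp: nsets_def)
          moreover have "\<pi> ` B \<subseteq> {1..n}"
            using \<open>B \<subseteq> {1..n}\<close> permutes_image[OF \<pi>] by blast
          moreover have "card (\<pi> ` B) = card B" using inj by (simp add: card_image inj_on_subset)
          ultimately show ?thesis by (simp add: nsets_def)
        qed
        then show "\<G> \<subseteq> nsets {1..n} k" by (auto simp: \<G>_def)
      qed (use k in simp)
      have "\<pi> ` Y \<subseteq> {1..n} - {1}"
        using xY(2) permutes_image[OF \<pi>] inj unfolding px by (auto simp: inj_def)
      moreover have "core_bound k s \<beta> \<le> card (\<pi> ` Y)"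
        using xY(3) inj by (simp add: m_def card_image inj_on_subset)
      moreover have "card {B \<in> \<G>. 1 \<notin> B \<and> y \<notin> B} < s" if "y \<in> \<pi> ` Y" for y
        using that xY(4) by (auto simp: count mem1 mem simp del: One_nat_def)
      moreover have "s + \<beta> \<le> card {B \<in> \<G>. 1 \<notin> B}"
        using ell ell_le_avoiding[OF fin, of x] by (simp add: count mem1 del: One_nat_def)
      ultimately have concl: "card \<G> + Z < X + s + t + bh" "card \<G> + Z + 1 = X + s + t + bh \<Longrightarrow>
          \<exists>A F. ?struct A F \<and> \<G> = ?fam A F"
        using G.star_case[OF assms(3) n1(1), of "\<pi> ` Y" \<beta>]
        unfolding m_def bh_def X_def Z_def by (blast, simp add: conj_assoc)
      have "isomorphic_families n \<F> \<G>"
        using \<pi> by (auto simp: isomorphic_families_def \<G>_def)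
      then show ?thesis using concl unfolding card\<G> by metis
    qed (use assms(3) in linarith)
    have eq: "int (card \<F>) = int X - int Z + int s + int t + int bh - 1
      \<longleftrightarrow> card \<F> + Z + 1 = X + s + t + bh" by linarith
    have le: "int (card \<F>) \<le> int X - int Z + int s + int t + int bh - 1"
      using main by linarith
    have "card \<F> + Z + 1 = X + s + t + bh \<longleftrightarrow>
      (\<exists>A F. ?struct A F \<and> isomorphic_families n \<F> (?fam A F))" (is "?L \<longleftrightarrow> ?R")
    proof
      show "?L \<Longrightarrow> ?R" by (rule main[THEN conjunct2, THEN mp])
    next
      assume ?R
      then show ?L
      proof (elim exE)
        fix A F assume AF: "?struct A F \<and> isomorphic_families n \<F> (?fam A F)"
        show ?L by (rule size[OF conjunct1[OF AF] conjunct2[OF AF]])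
      qed
    qed
    note eq = trans[OF eq this]
    from le eq show "int (card \<F>) \<le> int ((n - 1) choose (k - 1)) - int ((n - m - 1) choose (k - 1))
                      + int s + int t + int bh - 1 \<and>
     (int (card \<F>) = int ((n - 1) choose (k - 1)) - int ((n - m - 1) choose (k - 1))
                      + int s + int t + int bh - 1 \<longleftrightarrow>
      (\<exists>(A :: nat \<Rightarrow> nat set) (F :: nat \<Rightarrow> nat set).
         A ` {1..s + bh} \<subseteq> nsets {1..n} k \<and> F ` {1..t - 1} \<subseteq> nsets {1..n} k \<and>
         inj_on A {1..s + bh} \<and> inj_on F {1..t - 1} \<and>
         A ` {1..s + bh} \<inter> F ` {1..t - 1} = {} \<and>
         1 \<notin> (\<Union>i\<in>{1..s + bh}. A i) \<and>
         card (core (s + bh) A s) = m \<and>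
         (\<forall>i\<in>{1..t - 1}. F i \<in> star1 n k - star1_rel n k (s + bh) A s) \<and>
         union_intersecting s t (A ` {1..s + bh} \<union> F ` {1..t - 1}) \<and>
         isomorphic_families n \<F> (?fam A F)))"
      unfolding X_def Z_def conj_assoc by (rule conjI)
  qed
qed

end
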